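(* Let $E, A \in \mathbb{C}^{n \times n}$, $B \in \mathbb{C}^{n \times m}$, $C \in \mathbb{C}^{p \times n}$ be a realization of the transfer function $G(s) = C(sE - A)^{-1}B$. Suppose there exist matrices $T, W \in \mathbb{C}^{n \times n}$ (a generalized state-space transformation) such that $\widetilde{E} = W^{\mathsf H} E T$, $\widetilde{A} = W^{\mathsf H} A T$, $\widetilde{B} = W^{\mathsf H} B$, $\widetilde{C} = C T$ satisfy $$\widetilde{E} = \widetilde{E}^{\mathsf H} > 0, \qquad \widetilde{A} = \widetilde{A}^{\mathsf H} < 0, \qquad \widetilde{B} = \widetilde{C}^{\mathsf H}$$ (in particular $p = m$). Let $N \geq 1$, and let $\omega_1, \ldots, \omega_N$ be real nodes and $\xi_1, \ldots, \xi_N$ real weights such that $\mathrm{i}\omega_i E - A$ and $-\mathrm{i}\omega_i E - A$ are invertible for all $i$. Then, for every reduction order $r$ for which $\check{\Sigma}_1$ is invertible, the reduced-order model $\widehat{E}, \widehat{A}, \widehat{B}, \widehat{C}$ produced by symmetric Hermite quadrature-based balanced truncation from $G$, $G'$ and $\{(\omega_i, \xi_i)\}_{i=1}^N$ (as defined in the context) is asymptotically stable, i.e., all eigenvalues of the matrix pencil $\lambda \widehat{E} - \widehat{A}$ lie in the open left half-plane.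
   Context: $\mathrm{i}$ is the imaginary unit, $M^{\mathsf H}$ is the conjugate transpose, and for Hermitian matrices $>0$, $<0$ mean positive definite, negative definite. Hermite data matrices. Let $G'(s) = \frac{d}{ds}G(s)$. The nodes/weights $\{(\omega_i,\xi_i)\}_{i=1}^N$ encode a symmetric pair of quadrature rules: the right rule has nodes $\omega_i$ and weights $\xi_i$, the left rule has nodes $-\omega_i$ and the same weights $\xi_i$. The matrices $\mathbb{E}_L, \mathbb{A}_L \in \mathbb{C}^{pN \times mN}$, $\mathbb{B}_L \in \mathbb{C}^{pN \times m}$, $\mathbb{C}_L \in \mathbb{C}^{p \times mN}$ are defined through their $p \times m$ blocks, for $k, j = 1, \ldots, N$ ($k$ the block-row index, $j$ the block-column index): $$(\mathbb{E}_L)_{k,j} = \begin{cases} -\xi_k \xi_j\, G'(\mathrm{i}\omega_j) & \text{if } \omega_j = -\omega_k, \\[4pt] -\xi_k \xi_j\, \dfrac{G(-\mathrm{i}\omega_k) - G(\mathrm{i}\omega_j)}{-\mathrm{i}\omega_k - \mathrm{i}\omega_j} & \text{if } \omega_j \neq -\omega_k, \end{cases}$$ $$(\mathbb{A}_L)_{k,j} = \begin{cases} -\xi_k \xi_j \big( G(\mathrm{i}\omega_j) + \mathrm{i}\omega_j\, G'(\mathrm{i}\omega_j) \big) & \text{if } \omega_j = -\omega_k, \\[4pt] -\xi_k \xi_j\, \dfrac{-\mathrm{i}\omega_k G(-\mathrm{i}\omega_k) - \mathrm{i}\omega_j G(\mathrm{i}\omega_j)}{-\mathrm{i}\omega_k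 - \mathrm{i}\omega_j} & \text{if } \omega_j \neq -\omega_k, \end{cases}$$ $$(\mathbb{B}_L)_{k} = \xi_k\, G(-\mathrm{i}\omega_k), \qquad (\mathbb{C}_L)_{j} = \xi_j\, G(\mathrm{i}\omega_j).$$ Symmetric Hermite quadrature-based balanced truncation. Given the data matrices and a reduction order $r$, take a singular value decomposition $$\mathbb{E}_L = \begin{bmatrix} \check{U}_1 & \check{U}_2 \end{bmatrix} \begin{bmatrix} \check{\Sigma}_1 & 0 \\ 0 & \check{\Sigma}_2 \end{bmatrix} \begin{bmatrix} \check{V}_1^{\mathsf H} \\ \check{V}_2^{\mathsf H} \end{bmatrix},$$ where $\check{\Sigma}_1 \in \mathbb{R}^{r \times r}$ is diagonal and contains the $r$ largest singular values and the other blocks are partitioned accordingly. When $\check{\Sigma}_1$ is invertible, the output is $$\widehat{E} = I_r, \quad \widehat{A} = \check{\Sigma}_1^{-1/2} \check{U}_1^{\mathsf H} \mathbb{A}_L \check{V}_1 \check{\Sigma}_1^{-1/2}, \quad \widehat{B} = \check{\Sigma}_1^{-1/2} \check{U}_1^{\mathsf H} \mathbb{B}_L, \quad \widehat{C} = \mathbb{C}_L \check{V}_1 \check{\Sigma}_1^{-1/2}.$$ *)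

theory Defs
  imports
    "HOL-Analysis.Derivative"
    "Jordan_Normal_Form.Determinant"
    "Jordan_Normal_Form.Gauss_Jordan_Elimination"
    "Jordan_Normal_Form.Schur_Decomposition"
begin

section \<open>Definite, unitary and block matrices\<close>

definition hermitian_mat :: "complex mat \<Rightarrow> bool" where
  "hermitian_mat M \<longleftrightarrow> square_mat M \<and> mat_adjoint M = M"

text \<open>The quadratic form \<open>(M *\<^sub>v v) \<bullet>c v\<close> of a Hermitian matrix is real,
  so taking its real part loses nothing.\<close>

definition pos_def :: "complex mat \<Rightarrow> bool" where
  "pos_def M \<longleftrightarrow> hermitian_mat M \<and>
     (\<forall>v \<in> carrier_vec (dim_row M). v \<noteq> 0\<^sub>v (dim_row M) \<longrightarrow> 0 < Re ((M *\<^sub>v v) \<bullet>c v))"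

definition neg_def :: "complex mat \<Rightarrow> bool" where
  "neg_def M \<longleftrightarrow> hermitian_mat M \<and>
     (\<forall>v \<in> carrier_vec (dim_row M). v \<noteq> 0\<^sub>v (dim_row M) \<longrightarrow> Re ((M *\<^sub>v v) \<bullet>c v) < 0)"

definition unitary_mat :: "complex mat \<Rightarrow> bool" where
  "unitary_mat U \<longleftrightarrow> square_mat U \<and> mat_adjoint U * U = 1\<^sub>m (dim_row U)"

definition hcat :: "'a::zero mat \<Rightarrow> 'a mat \<Rightarrow> 'a mat" where
  "hcat M M' = four_block_mat M M' (0\<^sub>m 0 (dim_col M)) (0\<^sub>m 0 (dim_col M'))"

text \<open>The matrix with \<open>K \<times> J\<close> blocks, each of size \<open>p \<times> m\<close>, whose block in
  block row \<open>k\<close> and block column \<open>j\<close> (both counted from 0) is \<open>F k j\<close>.\<close>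

definition block_mat :: "nat \<Rightarrow> nat \<Rightarrow> nat \<Rightarrow> nat \<Rightarrow> (nat \<Rightarrow> nat \<Rightarrow> 'a mat) \<Rightarrow> 'a mat" where
  "block_mat p m K J F =
     mat (p * K) (m * J) (\<lambda>(a, b). F (a div p) (b div m) $$ (a mod p, b mod m))"

section \<open>Transfer functions and stability\<close>

text \<open>Only meaningful where \<open>s \<cdot>\<^sub>m E - A\<close> is invertible; elsewhere \<open>mat_inverse\<close> is \<open>None\<close>
  and the value is unspecified.\<close>

definition transfer_function ::
  "complex mat \<Rightarrow> complex mat \<Rightarrow> complex mat \<Rightarrow> complex mat \<Rightarrow> complex \<Rightarrow> complex mat" where
  "transfer_function E A B C s = C * the (mat_inverse (s \<cdot>\<^sub>m E - A)) * B"

definition mat_deriv :: "(complex \<Rightarrow> complex mat) \<Rightarrow> complex \<Rightarrow> complex mat" where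
  "mat_deriv G s = mat (dim_row (G s)) (dim_col (G s)) (\<lambda>ij. deriv (\<lambda>z. G z $$ ij) s)"

definition pencil_eigenvalue :: "complex mat \<Rightarrow> complex mat \<Rightarrow> complex \<Rightarrow> bool" where
  "pencil_eigenvalue E A \<mu> \<longleftrightarrow> det (\<mu> \<cdot>\<^sub>m E - A) = 0"

type_synonym state_space = "complex mat \<times> complex mat \<times> complex mat \<times> complex mat"

definition asymptotically_stable :: "state_space \<Rightarrow> bool" where
  "asymptotically_stable = (\<lambda>(E, A, B, C). \<forall>\<mu>. pencil_eigenvalue E A \<mu> \<longrightarrow> Re \<mu> < 0)"

section \<open>Hermite data matrices\<close>

text \<open>Nodes \<open>\<omega> i\<close> and weights \<open>\<xi> i\<close> are indexed by \<open>i < N\<close>;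
  \<open>G'\<close> is the derivative of \<open>G\<close>.\<close>

definition data_E ::
  "nat \<Rightarrow> nat \<Rightarrow> nat \<Rightarrow> (nat \<Rightarrow> real) \<Rightarrow> (nat \<Rightarrow> real) \<Rightarrow>
   (complex \<Rightarrow> complex mat) \<Rightarrow> (complex \<Rightarrow> complex mat) \<Rightarrow> complex mat" where
  "data_E p m N \<omega> \<xi> G G' = block_mat p m N N (\<lambda>k j.
     if \<omega> j = - \<omega> k
     then (- complex_of_real (\<xi> k * \<xi> j)) \<cdot>\<^sub>m G' (\<i> * \<omega> j)
     else (- complex_of_real (\<xi> k * \<xi> j) / (- \<i> * \<omega> k - \<i> * \<omega> j)) \<cdot>\<^sub>m
            (G (- \<i> * \<omega> k) - G (\<i> * \<omega> j)))"

definition data_A ::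
  "nat \<Rightarrow> nat \<Rightarrow> nat \<Rightarrow> (nat \<Rightarrow> real) \<Rightarrow> (nat \<Rightarrow> real) \<Rightarrow>
   (complex \<Rightarrow> complex mat) \<Rightarrow> (complex \<Rightarrow> complex mat) \<Rightarrow> complex mat" where
  "data_A p m N \<omega> \<xi> G G' = block_mat p m N N (\<lambda>k j.
     if \<omega> j = - \<omega> k
     then (- complex_of_real (\<xi> k * \<xi> j)) \<cdot>\<^sub>m
            (G (\<i> * \<omega> j) + (\<i> * \<omega> j) \<cdot>\<^sub>m G' (\<i> * \<omega> j))
     else (- complex_of_real (\<xi> k * \<xi> j) / (- \<i> * \<omega> k - \<i> * \<omega> j)) \<cdot>\<^sub>m
            ((- \<i> * \<omega> k) \<cdot>\<^sub>m G (- \<i> * \<omega> k) - (\<i> * \<omega> j) \<cdot>\<^sub>m G (\<i> * \<omega> j)))"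

definition data_B ::
  "nat \<Rightarrow> nat \<Rightarrow> nat \<Rightarrow> (nat \<Rightarrow> real) \<Rightarrow> (nat \<Rightarrow> real) \<Rightarrow>
   (complex \<Rightarrow> complex mat) \<Rightarrow> complex mat" where
  "data_B p m N \<omega> \<xi> G =
     block_mat p m N 1 (\<lambda>k _. complex_of_real (\<xi> k) \<cdot>\<^sub>m G (- \<i> * \<omega> k))"

definition data_C ::
  "nat \<Rightarrow> nat \<Rightarrow> nat \<Rightarrow> (nat \<Rightarrow> real) \<Rightarrow> (nat \<Rightarrow> real) \<Rightarrow>
   (complex \<Rightarrow> complex mat) \<Rightarrow> complex mat" where
  "data_C p m N \<omega> \<xi> G =
     block_mat p m 1 N (\<lambda>_ j. complex_of_real (\<xi> j) \<cdot>\<^sub>m G (\<i> * \<omega> j))"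

section \<open>Singular value decomposition and the reduced model\<close>

definition is_svd :: "complex mat \<Rightarrow> complex mat \<Rightarrow> real mat \<Rightarrow> complex mat \<Rightarrow> bool" where
  "is_svd M U S V \<longleftrightarrow>
     U \<in> carrier_mat (dim_row M) (dim_row M) \<and> unitary_mat U \<and>
     V \<in> carrier_mat (dim_col M) (dim_col M) \<and> unitary_mat V \<and>
     S \<in> carrier_mat (dim_row M) (dim_col M) \<and> diagonal_mat S \<and>
     (\<forall>i < min (dim_row M) (dim_col M). 0 \<le> S $$ (i, i)) \<and>
     M = U * map_mat complex_of_real S * mat_adjoint V"

text \<open>\<open>S1\<close> holds the \<open>r\<close> largest singular values. No order is imposed inside \<open>S1\<close> or inside
  \<open>S2\<close>, so the usual non-increasing order is a special case.\<close>

definition partitioned_svd ::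
  "complex mat \<Rightarrow> nat \<Rightarrow> complex mat \<Rightarrow> complex mat \<Rightarrow> real mat \<Rightarrow> real mat \<Rightarrow>
   complex mat \<Rightarrow> complex mat \<Rightarrow> bool" where
  "partitioned_svd M r U1 U2 S1 S2 V1 V2 \<longleftrightarrow>
     r \<le> dim_row M \<and> r \<le> dim_col M \<and>
     U1 \<in> carrier_mat (dim_row M) r \<and> U2 \<in> carrier_mat (dim_row M) (dim_row M - r) \<and>
     V1 \<in> carrier_mat (dim_col M) r \<and> V2 \<in> carrier_mat (dim_col M) (dim_col M - r) \<and>
     S1 \<in> carrier_mat r r \<and> S2 \<in> carrier_mat (dim_row M - r) (dim_col M - r) \<and>
     is_svd M (hcat U1 U2)
       (four_block_mat S1 (0\<^sub>m r (dim_col M - r)) (0\<^sub>m (dim_row M - r) r) S2)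
       (hcat V1 V2) \<and>
     (\<forall>i < r. \<forall>j < min (dim_row S2) (dim_col S2). S2 $$ (j, j) \<le> S1 $$ (i, i))"

text \<open>The matrix power \<open>S\<^sup>-\<^sup>1\<^sup>/\<^sup>2\<close>, for a diagonal \<open>S\<close> with positive diagonal entries.\<close>

definition diag_inv_sqrt :: "real mat \<Rightarrow> complex mat" where
  "diag_inv_sqrt S = mat_diag (dim_row S) (\<lambda>i. complex_of_real (1 / sqrt (S $$ (i, i))))"

definition reduced_model ::
  "nat \<Rightarrow> complex mat \<Rightarrow> complex mat \<Rightarrow> complex mat \<Rightarrow>
   complex mat \<Rightarrow> real mat \<Rightarrow> complex mat \<Rightarrow> state_space" where
  "reduced_model r AL BL CL U1 S1 V1 =
     (1\<^sub>m r,
      diag_inv_sqrt S1 * mat_adjoint U1 * AL * V1 * diag_inv_sqrt S1,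
      diag_inv_sqrt S1 * mat_adjoint U1 * BL,
      CL * V1 * diag_inv_sqrt S1)"

end

(* Write K s for the inverse of s E - A. The resolvent identity turns the divided differences and
   derivatives of G into products: block (k, j) of data_E is \<xi> k * \<xi> j * C K(s) E K(t) B with
   s = -\<i> \<omega> k and t = \<i> \<omega> j, and the same holds for data_A with A in place of E. In the symmetric
   coordinates Et = W^H E T, At = W^H A T the left factor C K(s) is the adjoint of the right factor
   at s's conjugate, so data_E = X^H Et X and data_A = X^H At X for one matrix X.
   Hence data_E is positive semidefinite, which forces U1 = V1 wherever the singular values are
   positive. With Y = X V1 S1^(-1/2) the reduced state matrix is therefore Y^H At Y, while
   Y^H Et Y = 1 shows that Y is injective; so the reduced state matrix is negative definite. *)

theory Submission
  imports Defs
begin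

section \<open>Adjoints and quadratic forms\<close>

lemma dim_mat_adjoint [simp]:
  "dim_row (mat_adjoint A) = dim_col A" "dim_col (mat_adjoint A) = dim_row A"
  unfolding mat_adjoint_def by simp_all

lemma mat_adjoint_carrier [simp]:
  "A \<in> carrier_mat n m \<Longrightarrow> mat_adjoint A \<in> carrier_mat m n"
  unfolding carrier_mat_def by simp

lemma index_mat_adjoint [simp]:
  fixes A :: "complex mat"
  assumes "i < dim_col A" "j < dim_row A"
  shows "mat_adjoint A $$ (i, j) = cnj (A $$ (j, i))"
  unfolding mat_adjoint_def using assms by (subst mat_of_rows_index) simp_all

lemma mat_adjoint_adjoint [simp]:
  fixes A :: "complex mat"
  shows "mat_adjoint (mat_adjoint A) = A"
  by (rule eq_matI) auto

lemma mat_adjoint_smult: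
  fixes A :: "complex mat"
  shows "mat_adjoint (c \<cdot>\<^sub>m A) = cnj c \<cdot>\<^sub>m mat_adjoint A"
  by (rule eq_matI) auto

lemma mat_adjoint_minus:
  fixes A B :: "complex mat"
  assumes "A \<in> carrier_mat n m" "B \<in> carrier_mat n m"
  shows "mat_adjoint (A - B) = mat_adjoint A - mat_adjoint B"
  using assms by (intro eq_matI) auto

lemma mat_adjoint_mult:
  fixes A B :: "complex mat"
  assumes "A \<in> carrier_mat n k" "B \<in> carrier_mat k m"
  shows "mat_adjoint (A * B) = mat_adjoint B * mat_adjoint A"
proof (rule eq_matI)
  fix i j assume "i < dim_row (mat_adjoint B * mat_adjoint A)" "j < dim_col (mat_adjoint B * mat_adjoint A)"
  then have ij: "i < m" "j < n" using assms by auto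
  have "mat_adjoint (A * B) $$ (i, j) = (\<Sum>l\<in>{0..<k}. cnj (A $$ (j, l) * B $$ (l, i)))"
    using assms ij by (simp add: scalar_prod_def)
  also have "\<dots> = (mat_adjoint B * mat_adjoint A) $$ (i, j)"
    using assms ij by (simp add: scalar_prod_def mult.commute)
  finally show "mat_adjoint (A * B) $$ (i, j) = (mat_adjoint B * mat_adjoint A) $$ (i, j)" .
qed (use assms in auto)

lemma cscalar_prod_adjoint:
  fixes P :: "complex mat"
  assumes "P \<in> carrier_mat n m" "x \<in> carrier_vec n" "v \<in> carrier_vec m"
  shows "(mat_adjoint P *\<^sub>v x) \<bullet>c v = x \<bullet>c (P *\<^sub>v v)"
proof -
  have "(mat_adjoint P *\<^sub>v x) \<bullet>c v = (\<Sum>i\<in>{0..<m}. \<Sum>j\<in>{0..<n}. cnj (P $$ (j, i)) * x $ j * cnj (v $ i))"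
    using assms by (simp add: scalar_prod_def sum_distrib_right)
  also have "\<dots> = (\<Sum>j\<in>{0..<n}. \<Sum>i\<in>{0..<m}. cnj (P $$ (j, i)) * x $ j * cnj (v $ i))"
    by (rule sum.swap)
  also have "\<dots> = x \<bullet>c (P *\<^sub>v v)"
    using assms by (simp add: scalar_prod_def sum_distrib_left mult_ac)
  finally show ?thesis .
qed

text \<open>Carries definiteness of \<open>M\<close> over to \<open>P\<close>-congruent matrices. It
  yields semidefiniteness of the data matrix and evaluates the quadratic form at an eigenvector of
  the reduced matrix.\<close>

lemma cscalar_prod_congruence:
  fixes P M :: "complex mat"
  assumes "P \<in> carrier_mat n m" "M \<in> carrier_mat n n" "v \<in> carrier_vec m"
  shows "((mat_adjoint P * M * P) *\<^sub>v v) \<bullet>c v = (M *\<^sub>v (P *\<^sub>v v)) \<bullet>c (P *\<^sub>v v)"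
proof -
  have Pv: "P *\<^sub>v v \<in> carrier_vec n" and MPv: "M *\<^sub>v (P *\<^sub>v v) \<in> carrier_vec n"
    using assms by auto
  have "(mat_adjoint P * M * P) *\<^sub>v v = (mat_adjoint P * M) *\<^sub>v (P *\<^sub>v v)"
    using assms by (intro assoc_mult_mat_vec) auto
  also have "\<dots> = mat_adjoint P *\<^sub>v (M *\<^sub>v (P *\<^sub>v v))"
    using assms Pv by (intro assoc_mult_mat_vec) auto
  finally show ?thesis
    using cscalar_prod_adjoint[OF assms(1) MPv assms(3)] by simp
qed

lemma cscalar_prod_self:
  fixes v :: "complex vec"
  assumes "v \<in> carrier_vec n"
  shows "Im (v \<bullet>c v) = 0" "v \<noteq> 0\<^sub>v n \<Longrightarrow> 0 < Re (v \<bullet>c v)"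
proof -
  have "0 \<le> v \<bullet>c v" by (rule conjugate_square_ge_0_vec)
  then show "Im (v \<bullet>c v) = 0" by (simp add: less_eq_complex_def)
  assume "v \<noteq> 0\<^sub>v n"
  then have "0 < v \<bullet>c v" using conjugate_square_greater_0_vec[OF assms] by simp
  then show "0 < Re (v \<bullet>c v)" by (simp add: less_complex_def)
qed

lemma pos_def_nonneg:
  assumes "pos_def E" "E \<in> carrier_mat n n" "v \<in> carrier_vec n"
  shows "0 \<le> Re ((E *\<^sub>v v) \<bullet>c v)"
proof (cases "v = 0\<^sub>v n")
  case True
  then show ?thesis using assms by (simp add: scalar_prod_def)
next
  case False
  then show ?thesis using assms by (auto simp: pos_def_def intro: less_imp_le)
qed

text \<open>A kernel vector would make the quadratic form vanish. The lemma serves to recover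
  invertibility of \<open>T\<close>, which is only implicit in definiteness of the transformed
  matrix.\<close>

lemma pos_def_det_nonzero:
  assumes "pos_def E" "E \<in> carrier_mat n n"
  shows "det E \<noteq> 0"
proof
  assume "det E = 0"
  then obtain v where v: "v \<in> carrier_vec n" "v \<noteq> 0\<^sub>v n" "E *\<^sub>v v = 0\<^sub>v n"
    using det_0_iff_vec_prod_zero[OF assms(2)] by auto
  moreover have "0\<^sub>v n \<bullet>c v = 0" using v by (simp add: scalar_prod_def)
  ultimately show False using assms by (auto simp: pos_def_def)
qed

section \<open>Inverses and their continuity\<close>

lemma invertible_mat_iff_det:
  fixes A :: "'a :: field mat"
  assumes A: "A \<in> carrier_mat n n"
  shows "invertible_mat A \<longleftrightarrow> det A \<noteq> 0"
proof
  assume "invertible_mat A"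
  then obtain B where B: "A * B = 1\<^sub>m (dim_row A)" "B * A = 1\<^sub>m (dim_row B)"
    unfolding invertible_mat_def inverts_mat_def by auto
  \<comment> \<open>\<open>invertible_mat\<close> does not fix the shape of the inverse, so both
    dimensions are read off from the two identity products.\<close>
  have "dim_row B = n" "dim_col B = n"
    using arg_cong[OF B(1), of dim_col] arg_cong[OF B(2), of dim_col] A by auto
  then have "B \<in> carrier_mat n n" by auto
  then have "det A * det B = det (1\<^sub>m n :: 'a mat)"
    using B A det_mult[OF A \<open>B \<in> carrier_mat n n\<close>] by simp
  then show "det A \<noteq> 0" by auto
next
  assume "det A \<noteq> 0"
  from det_non_zero_imp_unit[OF A this, of "()"]
  obtain B where "B \<in> carrier_mat n n" "A * B = 1\<^sub>m n" "B * A = 1\<^sub>m n"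
    by (auto simp: Units_def ring_mat_def)
  then show "invertible_mat A"
    using A by (auto simp: invertible_mat_def inverts_mat_def)
qed

lemma the_mat_inverse:
  fixes A :: "'a :: field mat"
  assumes A: "A \<in> carrier_mat n n" and "invertible_mat A"
  shows "the (mat_inverse A) \<in> carrier_mat n n"
    "A * the (mat_inverse A) = 1\<^sub>m n" "the (mat_inverse A) * A = 1\<^sub>m n"
proof -
  have "det A \<noteq> 0" using assms invertible_mat_iff_det by blast
  then have "A \<in> Units (ring_mat TYPE('a) n ())" by (rule det_non_zero_imp_unit[OF A])
  then obtain B where "mat_inverse A = Some B"
    using mat_inverse(1)[OF A, where b = "()"] by (cases "mat_inverse A") auto
  with mat_inverse(2)[OF A this] show "the (mat_inverse A) \<in> carrier_mat n n"
    "A * the (mat_inverse A) = 1\<^sub>m n" "the (mat_inverse A) * A = 1\<^sub>m n" by auto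
qed

text \<open>Cramer's rule, from evaluating \<open>adj_mat A * A * K\<close> in two ways. It makes
  the entries of an inverse rational in the entries of \<open>A\<close>, which is what gives their
  continuity.\<close>

lemma inverse_mat_index_cofactor:
  fixes A :: "'a :: field mat"
  assumes A: "A \<in> carrier_mat n n" and K: "K \<in> carrier_mat n n" and "A * K = 1\<^sub>m n"
    and ij: "i < n" "j < n"
  shows "K $$ (i, j) = cofactor A j i / det A"
proof -
  have "adj_mat A = adj_mat A * (A * K)" using assms adj_mat[OF A] by simp
  also have "\<dots> = adj_mat A * A * K"
    using assoc_mult_mat[OF adj_mat(1)[OF A] A K] by simp
  also have "\<dots> = det A \<cdot>\<^sub>m K"
    using adj_mat(3)[OF A] K by (simp add: mult_smult_assoc_mat[OF one_carrier_mat K])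
  finally have "adj_mat A $$ (i, j) = (det A \<cdot>\<^sub>m K) $$ (i, j)" by simp
  then have "cofactor A j i = det A * K $$ (i, j)"
    using A K ij by (simp add: adj_mat_def)
  moreover have "det A * det K = 1" using det_mult[OF A K] assms by simp
  then have "det A \<noteq> 0" by auto
  ultimately show ?thesis by simp
qed

section \<open>Continuity of determinants, products and inverses\<close>

lemma isCont_det:
  fixes M :: "'b :: t2_space \<Rightarrow> 'a :: real_normed_field mat"
  assumes "\<And>z. M z \<in> carrier_mat n n"
    and "\<And>i j. i < n \<Longrightarrow> j < n \<Longrightarrow> isCont (\<lambda>z. M z $$ (i, j)) a"
  shows "isCont (\<lambda>z. det (M z)) a"
proof -
  have "isCont (\<lambda>z. \<Sum>p | p permutes {0..<n}. signof p * (\<Prod>i = 0..<n. M z $$ (i, p i))) a"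
  proof (intro continuous_intros)
    fix p i assume "p \<in> {p. p permutes {0..<n}}" "i \<in> {0..<n}"
    then show "isCont (\<lambda>z. M z $$ (i, p i)) a"
      using assms(2) permutes_in_image by fastforce
  qed
  then show ?thesis using det_def'[OF assms(1)] by simp
qed

lemma isCont_cofactor:
  fixes M :: "'b :: t2_space \<Rightarrow> 'a :: real_normed_field mat"
  assumes M: "\<And>z. M z \<in> carrier_mat n n"
    and cont: "\<And>i j. i < n \<Longrightarrow> j < n \<Longrightarrow> isCont (\<lambda>z. M z $$ (i, j)) a"
    and ij: "i < n" "j < n"
  shows "isCont (\<lambda>z. cofactor (M z) i j) a"
proof -
  have "isCont (\<lambda>z. det (mat_delete (M z) i j)) a"
  proof (rule isCont_det[of _ "n - 1"])
    show "mat_delete (M z) i j \<in> carrier_mat (n - 1) (n - 1)" for z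
      by (rule mat_delete_carrier[OF M])
    fix k l assume "k < n - 1" "l < n - 1"
    then show "isCont (\<lambda>z. mat_delete (M z) i j $$ (k, l)) a"
      using M by (simp add: mat_delete_def carrier_matD[OF M] cont)
  qed
  then show ?thesis unfolding cofactor_def by (intro continuous_intros)
qed

lemma isCont_index_mult:
  fixes P Q :: "'b :: t2_space \<Rightarrow> 'a :: real_normed_field mat"
  assumes P: "\<And>z. P z \<in> carrier_mat n k" and Q: "\<And>z. Q z \<in> carrier_mat k m"
    and "\<And>i j. i < n \<Longrightarrow> j < k \<Longrightarrow> isCont (\<lambda>z. P z $$ (i, j)) a"
    and "\<And>i j. i < k \<Longrightarrow> j < m \<Longrightarrow> isCont (\<lambda>z. Q z $$ (i, j)) a"
    and ij: "i < n" "j < m"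
  shows "isCont (\<lambda>z. (P z * Q z) $$ (i, j)) a"
proof -
  have "(P z * Q z) $$ (i, j) = (\<Sum>l = 0..<k. P z $$ (i, l) * Q z $$ (l, j))" for z
    using ij carrier_matD[OF P, of z] carrier_matD[OF Q, of z] by (simp add: scalar_prod_def)
  then show ?thesis using assms by (auto intro!: continuous_intros)
qed

lemma isCont_imp_eventually_ne:
  fixes f :: "'a :: t2_space \<Rightarrow> 'b :: t1_space"
  assumes "isCont f a" "f a \<noteq> c"
  shows "\<forall>\<^sub>F z in nhds a. f z \<noteq> c"
  using assms tendsto_at_iff_tendsto_nhds[of f a] tendsto_imp_eventually_ne[of f "f a" "nhds a" c]
  by (simp add: isCont_def)

text \<open>Cramer's quotient is continuous at \<open>a\<close>. As \<open>K\<close> is constrained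
  only where the determinant is nonzero, it equals that quotient merely in a neighbourhood of
  \<open>a\<close>, which suffices. This matches \<open>mat_inverse\<close>, whose value at singular
  matrices is unusable.\<close>

lemma isCont_index_inverse_mat:
  fixes M K :: "'b :: t2_space \<Rightarrow> 'a :: real_normed_field mat"
  assumes M: "\<And>z. M z \<in> carrier_mat n n"
    and cont: "\<And>i j. i < n \<Longrightarrow> j < n \<Longrightarrow> isCont (\<lambda>z. M z $$ (i, j)) a"
    and K: "\<And>z. det (M z) \<noteq> 0 \<Longrightarrow> K z \<in> carrier_mat n n \<and> M z * K z = 1\<^sub>m n"
    and "det (M a) \<noteq> 0" and ij: "i < n" "j < n"
  shows "isCont (\<lambda>z. K z $$ (i, j)) a"
proof -
  have det: "isCont (\<lambda>z. det (M z)) a" using M cont by (rule isCont_det)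
  have "isCont (\<lambda>z. cofactor (M z) j i / det (M z)) a"
    using isCont_cofactor[OF M cont ij(2,1)] det assms(4) by (intro continuous_intros) auto
  moreover have "\<forall>\<^sub>F z in nhds a. det (M z) \<noteq> 0"
    using det assms(4) by (rule isCont_imp_eventually_ne)
  then have "\<forall>\<^sub>F z in nhds a. K z $$ (i, j) = cofactor (M z) j i / det (M z)"
    by eventually_elim (use K M ij inverse_mat_index_cofactor in blast)
  then have "isCont (\<lambda>z. K z $$ (i, j)) a = isCont (\<lambda>z. cofactor (M z) j i / det (M z)) a"
    by (rule isCont_cong)
  ultimately show ?thesis by simp
qed

lemma eventually_nhds_imp_at:
  "eventually P (nhds a) \<Longrightarrow> eventually P (at a)"
  by (simp add: eventually_at_filter eventually_mono)

section \<open>Singular value decomposition of positive semidefinite matrices\<close>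

lemma real_diagonal_mat_of_real:
  fixes S :: "real mat"
  assumes S: "S \<in> carrier_mat d d" and "diagonal_mat S"
  shows "map_mat complex_of_real S = mat_diag d (\<lambda>i. complex_of_real (S $$ (i, i)))"
  using assms by (intro eq_matI) (auto simp: mat_diag_def diagonal_mat_def)

lemma mat_adjoint_real_diag:
  "mat_adjoint (mat_diag d (\<lambda>i. complex_of_real (f i))) = mat_diag d (\<lambda>i. complex_of_real (f i))"
  by (intro eq_matI) (auto simp: mat_diag_def)

lemma unitary_mat_inverse:
  assumes "unitary_mat U" "U \<in> carrier_mat d d"
  shows "mat_adjoint U * U = 1\<^sub>m d"
  using assms by (simp add: unitary_mat_def)

text \<open>Multiplying the factorization by \<open>V\<close>, and its adjoint by \<open>U\<close>,
  cancels one unitary factor each. Column by column these are the relations between left and right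
  singular vectors; the adjoint of \<open>D\<close> is \<open>D\<close> because its entries are
  real.\<close>

lemma svd_singular_vectors:
  assumes svd: "is_svd M U S V" and M: "M \<in> carrier_mat d d"
  defines "D \<equiv> mat_diag d (\<lambda>i. complex_of_real (S $$ (i, i)))"
  shows "M * V = U * D" "mat_adjoint M * U = V * D"
proof -
  have U: "U \<in> carrier_mat d d" and V: "V \<in> carrier_mat d d" and S: "S \<in> carrier_mat d d"
    and uU: "mat_adjoint U * U = 1\<^sub>m d" and uV: "mat_adjoint V * V = 1\<^sub>m d"
    and "diagonal_mat S" and "M = U * map_mat complex_of_real S * mat_adjoint V"
    using svd M unitary_mat_inverse by (auto simp: is_svd_def)
  then have M_eq: "M = U * D * mat_adjoint V"
    using real_diagonal_mat_of_real unfolding D_def by simp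
  have D: "D \<in> carrier_mat d d" by (simp add: D_def)
  have UD: "U * D \<in> carrier_mat d d" and VD: "V * D \<in> carrier_mat d d"
    using U V D by auto
  have "M * V = U * D * (mat_adjoint V * V)"
    unfolding M_eq using UD V by (intro assoc_mult_mat) auto
  then show "M * V = U * D" using uV right_mult_one_mat[OF UD] by simp
  have "mat_adjoint M = V * mat_adjoint (U * D)"
    unfolding M_eq using mat_adjoint_mult[OF UD mat_adjoint_carrier[OF V]] by simp
  also have "mat_adjoint (U * D) = D * mat_adjoint U"
    using mat_adjoint_mult[OF U D] mat_adjoint_real_diag unfolding D_def by simp
  also have "V * (D * mat_adjoint U) = V * D * mat_adjoint U"
    using U V D by (intro assoc_mult_mat[symmetric]) auto
  finally have "mat_adjoint M * U = V * D * mat_adjoint U * U" by simp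
  also have "\<dots> = V * D * (mat_adjoint U * U)"
    using VD U by (intro assoc_mult_mat) auto
  finally show "mat_adjoint M * U = V * D" using uU right_mult_one_mat[OF VD] by simp
qed

lemma col_mult_mat_diag:
  fixes U :: "'a :: comm_semiring_1 mat"
  assumes "U \<in> carrier_mat n d" "i < d"
  shows "col (U * mat_diag d f) i = f i \<cdot>\<^sub>v col U i"
  using assms by (intro eq_vecI) (auto simp: mat_diag_mult_right[of U n] mult.commute)

text \<open>From \<open>M v = \<sigma> u\<close> and \<open>M u = \<sigma> v\<close> one gets \<open>M (u - v) = - \<sigma> (u - v)\<close>, which
  positive semidefiniteness only allows for \<open>u = v\<close>.\<close>

lemma psd_singular_vectors_eq:
  fixes M :: "complex mat"
  assumes M: "M \<in> carrier_mat d d"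
    and psd: "\<forall>x \<in> carrier_vec d. 0 \<le> Re ((M *\<^sub>v x) \<bullet>c x)"
    and u: "u \<in> carrier_vec d" and v: "v \<in> carrier_vec d"
    and Mv: "M *\<^sub>v v = complex_of_real \<sigma> \<cdot>\<^sub>v u" and Mu: "M *\<^sub>v u = complex_of_real \<sigma> \<cdot>\<^sub>v v"
    and "0 < \<sigma>"
  shows "u = v"
proof (rule ccontr)
  assume "u \<noteq> v"
  define w where "w = u - v"
  have w: "w \<in> carrier_vec d" using u v by (simp add: w_def)
  have "w \<noteq> 0\<^sub>v d"
  proof
    assume "w = 0\<^sub>v d"
    then have "w $ i = 0" if "i < d" for i using that by simp
    then have "u $ i = v $ i" if "i < d" for i
      using that u v by (simp add: w_def)
    then show False using \<open>u \<noteq> v\<close> u v by (auto intro: eq_vecI)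
  qed
  have "M *\<^sub>v w = M *\<^sub>v u - M *\<^sub>v v"
    unfolding w_def by (rule mult_minus_distrib_mat_vec[OF M u v])
  also have "\<dots> = (- complex_of_real \<sigma>) \<cdot>\<^sub>v w"
    unfolding Mu Mv w_def using u v by (intro eq_vecI) (auto simp: algebra_simps)
  finally have "(M *\<^sub>v w) \<bullet>c w = - complex_of_real \<sigma> * (w \<bullet>c w)"
    using w by simp
  then have "Re ((M *\<^sub>v w) \<bullet>c w) = - \<sigma> * Re (w \<bullet>c w)" by simp
  moreover have "0 < \<sigma> * Re (w \<bullet>c w)"
    using cscalar_prod_self(2)[OF w \<open>w \<noteq> 0\<^sub>v d\<close>] \<open>0 < \<sigma>\<close> by simp
  ultimately show False using bspec[OF psd w] by simp
qed

lemma col_hcat: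
  assumes "U1 \<in> carrier_mat d r" "U2 \<in> carrier_mat d k" "i < r"
  shows "col (hcat U1 U2) i = col U1 i"
  using assms by (intro eq_vecI) (auto simp: hcat_def)

lemma index_mat_adjoint_mult:
  fixes P Q :: "complex mat"
  assumes "P \<in> carrier_mat n k" "Q \<in> carrier_mat n l" "a < k" "b < l"
  shows "(mat_adjoint P * Q) $$ (a, b) = col Q b \<bullet>c col P a"
  using assms by (auto simp: scalar_prod_def mult.commute)

text \<open>The leading r x r block of V^H V only involves the first r columns of V, which are those
  of \<open>V1\<close>.\<close>

lemma unitary_hcat_left:
  assumes "unitary_mat (hcat V1 V2)" "V1 \<in> carrier_mat d r" "V2 \<in> carrier_mat d (d - r)" "r \<le> d"
  shows "mat_adjoint V1 * V1 = 1\<^sub>m r"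
proof (rule eq_matI)
  let ?V = "hcat V1 V2"
  have V: "?V \<in> carrier_mat d d"
    using assms by (auto simp: hcat_def)
  fix i j assume "i < dim_row (1\<^sub>m r :: complex mat)" "j < dim_col (1\<^sub>m r :: complex mat)"
  then have ij: "i < r" "j < r" by auto
  have "(mat_adjoint V1 * V1) $$ (i, j) = (mat_adjoint ?V * ?V) $$ (i, j)"
    using ij assms by (simp add: index_mat_adjoint_mult[OF assms(2,2)] index_mat_adjoint_mult[OF V V]
        col_hcat[OF assms(2,3)] del: index_mult_mat)
  then show "(mat_adjoint V1 * V1) $$ (i, j) = 1\<^sub>m r $$ (i, j)"
    using unitary_mat_inverse[OF assms(1) V] ij assms by simp
qed (use assms in auto)

text \<open>For Hermitian \<open>M\<close> the two singular vector relations become symmetric in u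
  and v, so \<open>psd_singular_vectors_eq\<close> identifies the retained columns one at a time.
  Invertibility of \<open>S1\<close> supplies the strict positivity that this needs. The columns of
  \<open>V1\<close> are then orthonormal eigenvectors of \<open>M\<close>.\<close>

lemma psd_partitioned_svd:
  fixes M :: "complex mat"
  assumes M: "M \<in> carrier_mat d d" and herm: "mat_adjoint M = M"
    and psd: "\<forall>x \<in> carrier_vec d. 0 \<le> Re ((M *\<^sub>v x) \<bullet>c x)"
    and svd: "partitioned_svd M r U1 U2 S1 S2 V1 V2" and "invertible_mat S1"
  shows "U1 \<in> carrier_mat d r" "S1 \<in> carrier_mat r r" "U1 = V1" "mat_adjoint V1 * V1 = 1\<^sub>m r"
    "\<And>i. i < r \<Longrightarrow> 0 < S1 $$ (i, i)"
    "M * V1 = V1 * mat_diag r (\<lambda>i. complex_of_real (S1 $$ (i, i)))"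
proof -
  let ?S = "four_block_mat S1 (0\<^sub>m r (d - r)) (0\<^sub>m (d - r) r) S2"
  let ?U = "hcat U1 U2" and ?V = "hcat V1 V2"
  have r: "r \<le> d" and U1: "U1 \<in> carrier_mat d r" and U2: "U2 \<in> carrier_mat d (d - r)"
    and V1: "V1 \<in> carrier_mat d r" and V2: "V2 \<in> carrier_mat d (d - r)"
    and S1: "S1 \<in> carrier_mat r r" and S2: "S2 \<in> carrier_mat (d - r) (d - r)"
    and is_svd: "is_svd M ?U ?S ?V"
    using svd M by (auto simp: partitioned_svd_def)
  have U: "?U \<in> carrier_mat d d" and V: "?V \<in> carrier_mat d d"
    using U1 U2 V1 V2 r by (auto simp: hcat_def)
  have S_index: "?S $$ (i, j) = S1 $$ (i, j)" if "i < r" "j < r" for i j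
    using that S1 S2 by simp
  have diag: "diagonal_mat ?S" and nonneg: "\<And>i. i < d \<Longrightarrow> 0 \<le> ?S $$ (i, i)"
    using is_svd M by (auto simp: is_svd_def)
  have dimS: "dim_row ?S = d" "dim_col ?S = d" using S1 S2 r by auto
  \<comment> \<open>\<open>S1\<close> inherits diagonality from the full singular value matrix. The
    triangular form turns its determinant into the product of the singular values, so none of them
    is zero.\<close>
  have "upper_triangular S1"
    using diag S1 S_index r dimS unfolding diagonal_mat_def
    by (intro upper_triangularI) (metis carrier_matD(1) less_trans nat_neq_iff less_le_trans)
  then have "det S1 = prod_list (diag_mat S1)"
    using S1 by (rule det_upper_triangular)
  moreover have "det S1 \<noteq> 0" using \<open>invertible_mat S1\<close> invertible_mat_iff_det[OF S1] by simp
  ultimately have "S1 $$ (i, i) \<noteq> 0" if "i < r" for i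
    using that S1 by (auto simp: prod_list_zero_iff diag_mat_def)
  then show pos: "0 < S1 $$ (i, i)" if "i < r" for i
    using that nonneg[of i] S_index[of i i] r by (simp add: order_le_less)
  note sv = svd_singular_vectors[OF is_svd M, unfolded herm]
  have Mv: "M *\<^sub>v col V1 i = complex_of_real (S1 $$ (i, i)) \<cdot>\<^sub>v col U1 i"
    and Mu: "M *\<^sub>v col U1 i = complex_of_real (S1 $$ (i, i)) \<cdot>\<^sub>v col V1 i" if "i < r" for i
  proof -
    have i: "i < d" using that r by simp
    show "M *\<^sub>v col V1 i = complex_of_real (S1 $$ (i, i)) \<cdot>\<^sub>v col U1 i"
      using arg_cong[OF sv(1), of "\<lambda>X. col X i"] col_mult2[OF M V i] col_mult_mat_diag[OF U i]
        S_index[OF that that] col_hcat[OF U1 U2 that] col_hcat[OF V1 V2 that] by simp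
    show "M *\<^sub>v col U1 i = complex_of_real (S1 $$ (i, i)) \<cdot>\<^sub>v col V1 i"
      using arg_cong[OF sv(2), of "\<lambda>X. col X i"] col_mult2[OF M U i] col_mult_mat_diag[OF V i]
        S_index[OF that that] col_hcat[OF U1 U2 that] col_hcat[OF V1 V2 that] by simp
  qed
  have col_eq: "col U1 i = col V1 i" if "i < r" for i
    using psd_singular_vectors_eq[OF M psd _ _ Mv Mu pos] that U1 V1 by simp
  show "U1 = V1"
    using U1 V1 col_eq by (intro mat_col_eqI) auto
  show "mat_adjoint V1 * V1 = 1\<^sub>m r"
    using is_svd V1 V2 r by (intro unitary_hcat_left) (auto simp: is_svd_def)
  show "M * V1 = V1 * mat_diag r (\<lambda>i. complex_of_real (S1 $$ (i, i)))"
  proof (rule mat_col_eqI)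
    fix i assume "i < dim_col (V1 * mat_diag r (\<lambda>i. complex_of_real (S1 $$ (i, i))))"
    then have i: "i < r" using V1 by (simp add: mat_diag_def)
    show "col (M * V1) i = col (V1 * mat_diag r (\<lambda>i. complex_of_real (S1 $$ (i, i)))) i"
      using col_mult2[OF M V1 i] col_mult_mat_diag[OF V1 i] Mv[OF i] col_eq[OF i] by simp
  qed (use M V1 in \<open>auto simp: mat_diag_def\<close>)
qed (use svd M in \<open>auto simp: partitioned_svd_def\<close>)

section \<open>Resolvent identities for transfer functions\<close>

text \<open>The resolvent identities do not involve the symmetry of the system, so \<open>p\<close>
  and \<open>m\<close> stay independent; the symmetrizing transformation enters from
  \<open>symmetric_left_factor\<close> on.\<close>

locale descriptor_system =
  fixes n m p :: nat and E A B C :: "complex mat"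
  assumes E: "E \<in> carrier_mat n n" and A: "A \<in> carrier_mat n n"
    and B: "B \<in> carrier_mat n m" and C: "C \<in> carrier_mat p n"
begin

definition pencil :: "complex \<Rightarrow> complex mat" where
  "pencil s = s \<cdot>\<^sub>m E - A"

definition res :: "complex \<Rightarrow> complex mat" where
  "res s = the (mat_inverse (pencil s))"

abbreviation G :: "complex \<Rightarrow> complex mat" where
  "G \<equiv> transfer_function E A B C"

lemma pencil_carrier [simp]: "pencil s \<in> carrier_mat n n"
  unfolding pencil_def by (rule minus_carrier_mat[OF A])

lemma res_inverse:
  assumes "invertible_mat (pencil s)"
  shows "res s \<in> carrier_mat n n" "pencil s * res s = 1\<^sub>m n" "res s * pencil s = 1\<^sub>m n"
  using the_mat_inverse[OF pencil_carrier assms] by (auto simp: res_def)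

lemma G_eq: "G s = C * res s * B"
  by (simp add: transfer_function_def res_def pencil_def)

text \<open>Both divided differences in the data matrices are instances of this identity:
  \<open>a = - b = 1\<close> gives \<open>E\<close>, and \<open>a = s\<close>, \<open>b = - t\<close> gives \<open>A\<close>.\<close>

lemma transfer_function_combination:
  assumes s: "invertible_mat (pencil s)" and t: "invertible_mat (pencil t)"
    and M: "M \<in> carrier_mat n n" and "a \<cdot>\<^sub>m pencil t + b \<cdot>\<^sub>m pencil s = c \<cdot>\<^sub>m M"
  shows "a \<cdot>\<^sub>m G s + b \<cdot>\<^sub>m G t = c \<cdot>\<^sub>m (C * res s * M * res t * B)"
proof -
  note Ks = res_inverse[OF s] and Kt = res_inverse[OF t]
  note carr = Ks(1) Kt(1) M B C pencil_carrier[of s] pencil_carrier[of t]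
  \<comment> \<open>Each pencil cancels the resolvent at its own point: \<open>pencil t\<close>
    against the right factor, \<open>pencil s\<close> against the left one.\<close>
  have "a \<cdot>\<^sub>m res s + b \<cdot>\<^sub>m res t = res s * (a \<cdot>\<^sub>m pencil t + b \<cdot>\<^sub>m pencil s) * res t"
  proof -
    have "res s * (a \<cdot>\<^sub>m pencil t + b \<cdot>\<^sub>m pencil s) * res t =
        a \<cdot>\<^sub>m (res s * pencil t * res t) + b \<cdot>\<^sub>m (res s * pencil s * res t)"
      using carr
      by (simp add: mult_add_distrib_mat[of _ n n _ n] add_mult_distrib_mat[of _ n n _ _ n]
          mult_smult_distrib[of _ n n _ n] mult_smult_assoc_mat[of _ n n _ n])
    moreover have "res s * pencil t * res t = res s * (pencil t * res t)"
      using carr by (intro assoc_mult_mat) auto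
    ultimately show ?thesis using carr Ks Kt by simp
  qed
  then have res: "a \<cdot>\<^sub>m res s + b \<cdot>\<^sub>m res t = c \<cdot>\<^sub>m (res s * M * res t)"
    using assms(4) carr
    by (simp add: mult_smult_distrib[of _ n n _ n] mult_smult_assoc_mat[of _ n n _ n])
  have "a \<cdot>\<^sub>m G s + b \<cdot>\<^sub>m G t = C * (a \<cdot>\<^sub>m res s + b \<cdot>\<^sub>m res t) * B"
    using carr unfolding G_eq
    by (simp add: mult_add_distrib_mat[of _ p n _ n] add_mult_distrib_mat[of _ p n _ _ m]
        mult_smult_distrib[of _ p n _ n] mult_smult_assoc_mat[of _ p n _ m])
  also have "\<dots> = c \<cdot>\<^sub>m (C * (res s * M * res t) * B)"
    unfolding res using carr
    by (simp add: mult_smult_distrib[of _ p n _ n] mult_smult_assoc_mat[of _ p n _ m])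
  also have "C * (res s * M * res t) = C * res s * M * res t"
    using carr by (simp add: assoc_mult_mat[of _ p n _ n _ n] assoc_mult_mat[of _ n n _ n _ n])
  finally show ?thesis .
qed

lemma transfer_function_diff:
  assumes "invertible_mat (pencil s)" "invertible_mat (pencil t)"
  shows "G s - G t = (t - s) \<cdot>\<^sub>m (C * res s * E * res t * B)"
proof -
  have "1 \<cdot>\<^sub>m pencil t + (- 1) \<cdot>\<^sub>m pencil s = (t - s) \<cdot>\<^sub>m E"
    using E A by (intro eq_matI) (auto simp: pencil_def algebra_simps)
  from transfer_function_combination[OF assms E this]
  have "1 \<cdot>\<^sub>m G s + (- 1) \<cdot>\<^sub>m G t = (t - s) \<cdot>\<^sub>m (C * res s * E * res t * B)" .
  moreover have "1 \<cdot>\<^sub>m G s + (- 1) \<cdot>\<^sub>m G t = G s - G t"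
    by (intro eq_matI) (auto simp: G_eq)
  ultimately show ?thesis by simp
qed

lemma transfer_function_scaled_diff:
  assumes "invertible_mat (pencil s)" "invertible_mat (pencil t)"
  shows "s \<cdot>\<^sub>m G s - t \<cdot>\<^sub>m G t = (t - s) \<cdot>\<^sub>m (C * res s * A * res t * B)"
proof -
  have "s \<cdot>\<^sub>m pencil t + (- t) \<cdot>\<^sub>m pencil s = (t - s) \<cdot>\<^sub>m A"
    using E A by (intro eq_matI) (auto simp: pencil_def algebra_simps)
  from transfer_function_combination[OF assms A this]
  have "s \<cdot>\<^sub>m G s + (- t) \<cdot>\<^sub>m G t = (t - s) \<cdot>\<^sub>m (C * res s * A * res t * B)" .
  moreover have "s \<cdot>\<^sub>m G s + (- t) \<cdot>\<^sub>m G t = s \<cdot>\<^sub>m G s - t \<cdot>\<^sub>m G t"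
    by (intro eq_matI) (auto simp: G_eq)
  ultimately show ?thesis by simp
qed

section \<open>Derivative of the transfer function\<close>

lemma isCont_index_res:
  assumes "invertible_mat (pencil t)" "i < n" "j < n"
  shows "isCont (\<lambda>z. res z $$ (i, j)) t"
proof (rule isCont_index_inverse_mat[of pencil n])
  show "isCont (\<lambda>z. pencil z $$ (k, l)) t" if "k < n" "l < n" for k l
    using that E A by (auto simp: pencil_def intro!: continuous_intros)
  show "res z \<in> carrier_mat n n \<and> pencil z * res z = 1\<^sub>m n" if "det (pencil z) \<noteq> 0" for z
    using that res_inverse invertible_mat_iff_det[OF pencil_carrier] by blast
  show "det (pencil t) \<noteq> 0"
    using assms(1) invertible_mat_iff_det[OF pencil_carrier] by blast
qed (use assms in auto)

lemma eventually_invertible_pencil: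
  assumes "invertible_mat (pencil t)"
  shows "\<forall>\<^sub>F z in nhds t. invertible_mat (pencil z)"
proof -
  have "isCont (\<lambda>z. det (pencil z)) t"
    using E A by (intro isCont_det[of _ n]) (auto simp: pencil_def intro!: continuous_intros)
  moreover have "det (pencil t) \<noteq> 0"
    using assms invertible_mat_iff_det[OF pencil_carrier] by blast
  ultimately have "\<forall>\<^sub>F z in nhds t. det (pencil z) \<noteq> 0"
    by (rule isCont_imp_eventually_ne)
  then show ?thesis
    by eventually_elim (use invertible_mat_iff_det[OF pencil_carrier] in blast)
qed

text \<open>By \<open>transfer_function_diff\<close> the difference quotient at \<open>z\<close> is
  minus \<open>C * res z * E * res t * B\<close>. Only the factor \<open>res z\<close> varies, so
  continuity of the resolvent at \<open>t\<close> gives the limit.\<close>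

lemma mat_deriv_transfer_function:
  assumes t: "invertible_mat (pencil t)"
  shows "mat_deriv G t = (- 1) \<cdot>\<^sub>m (C * res t * E * res t * B)"
proof (rule eq_matI)
  let ?X = "\<lambda>z. C * res z * E * res t * B"
  fix i j assume "i < dim_row ((- 1) \<cdot>\<^sub>m ?X t)" "j < dim_col ((- 1) \<cdot>\<^sub>m ?X t)"
  then have ij: "i < p" "j < m" using B C by auto
  note rt = res_inverse(1)[OF t]
  \<comment> \<open>Where the pencil is singular, \<open>res z\<close> has unspecified dimensions.
    \<open>R\<close> forces the size n x n at every \<open>z\<close>, as
    \<open>isCont_index_mult\<close> demands, and agrees with \<open>res\<close> wherever the pencil
    is invertible, hence near \<open>t\<close>.\<close>
  define R where "R z = mat n n (\<lambda>kl. res z $$ kl)" for z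
  have R: "R z = res z" if "invertible_mat (pencil z)" for z
    using res_inverse(1)[OF that] unfolding R_def by (intro eq_matI) auto
  have "isCont (\<lambda>z. (C * R z * (E * res t * B)) $$ (i, j)) t"
  proof (rule isCont_index_mult[where n = p and k = n and m = m])
    fix k l assume "k < p" "l < n"
    then show "isCont (\<lambda>z. (C * R z) $$ (k, l)) t"
      using C isCont_index_res[OF t]
      by (intro isCont_index_mult[where n = p and k = n and m = n]) (auto simp: R_def)
  qed (use C E B rt ij in \<open>auto simp: R_def\<close>)
  moreover have neq: "\<forall>\<^sub>F z in at t. z \<noteq> t" by (rule eventually_neq_at_within)
  have "\<forall>\<^sub>F z in at t. (G z $$ (i, j) - G t $$ (i, j)) / (z - t) =
      - (C * R z * (E * res t * B)) $$ (i, j)"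
    using eventually_nhds_imp_at[OF eventually_invertible_pencil[OF t]] neq
  proof eventually_elim
    case (elim z)
    note rz = res_inverse(1)[OF elim(1)]
    have "C * R z * (E * res t * B) = C * res z * E * res t * B"
      using C rz rt E B unfolding R[OF elim(1)]
      by (simp add: assoc_mult_mat[of _ p n _ n _ n] assoc_mult_mat[of _ p n _ n _ m]
          assoc_mult_mat[of _ n n _ n _ m] assoc_mult_mat[of _ n n _ n _ n])
    moreover have "(G z - G t) $$ (i, j) = (t - z) * ?X z $$ (i, j)"
      using ij B C rz rt E unfolding transfer_function_diff[OF elim(1) t] by simp
    then have "G z $$ (i, j) - G t $$ (i, j) = (t - z) * ?X z $$ (i, j)"
      using ij B C by (simp add: G_eq)
    moreover have "(t - z) * x / (z - t) = - x" for x
      using elim(2) by (simp add: field_simps)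
    ultimately show ?case by simp
  qed
  ultimately have "((\<lambda>z. (G z $$ (i, j) - G t $$ (i, j)) / (z - t)) \<longlongrightarrow>
      - (C * R t * (E * res t * B)) $$ (i, j)) (at t)"
    using tendsto_cong isCont_def tendsto_minus by fastforce
  moreover have "C * R t * (E * res t * B) = ?X t"
    using C rt E B unfolding R[OF t]
    by (simp add: assoc_mult_mat[of _ p n _ n _ n] assoc_mult_mat[of _ p n _ n _ m]
        assoc_mult_mat[of _ n n _ n _ m] assoc_mult_mat[of _ n n _ n _ n])
  ultimately have "((\<lambda>z. G z $$ (i, j)) has_field_derivative - ?X t $$ (i, j)) (at t)"
    by (simp add: has_field_derivative_iff)
  then have "deriv (\<lambda>z. G z $$ (i, j)) t = - ?X t $$ (i, j)" by (rule DERIV_imp_deriv)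
  then show "mat_deriv G t $$ (i, j) = ((- 1) \<cdot>\<^sub>m ?X t) $$ (i, j)"
    using ij B C by (simp add: mat_deriv_def G_eq)
qed (use B C in \<open>auto simp: mat_deriv_def G_eq\<close>)

text \<open>The confluent case of \<open>transfer_function_scaled_diff\<close>: the left side is the
  derivative of s G(s) at \<open>t\<close>. Inserting the pencil between two resolvents reproduces
  G(t), and splitting it as t E - A leaves a term that cancels t G'(t).\<close>

lemma transfer_function_plus_deriv:
  assumes t: "invertible_mat (pencil t)"
  shows "G t + t \<cdot>\<^sub>m mat_deriv G t = (- 1) \<cdot>\<^sub>m (C * res t * A * res t * B)"
proof -
  note rt = res_inverse(1)[OF t]
  note carr = rt A B C E
  have assoc_res: "C * res t * M * res t * B = C * res t * M * (res t * B)"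
    if "M \<in> carrier_mat n n" for M
    using carr that by (intro assoc_mult_mat) auto
  \<comment> \<open>The combination lemma at equal points with coefficients 1 and 0 inserts the
    pencil between two copies of \<open>res t\<close>.\<close>
  have "1 \<cdot>\<^sub>m pencil t + 0 \<cdot>\<^sub>m pencil t = 1 \<cdot>\<^sub>m pencil t"
    using pencil_carrier[of t] by (intro eq_matI) auto
  from transfer_function_combination[OF t t pencil_carrier this]
  have "1 \<cdot>\<^sub>m G t + 0 \<cdot>\<^sub>m G t = 1 \<cdot>\<^sub>m (C * res t * pencil t * res t * B)" .
  moreover have "1 \<cdot>\<^sub>m G t + 0 \<cdot>\<^sub>m G t = G t" "1 \<cdot>\<^sub>m M = M" for M :: "complex mat"
    by (auto intro!: eq_matI simp: G_eq)
  ultimately have "G t = C * res t * pencil t * res t * B" by simp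
  also have "\<dots> = C * res t * pencil t * (res t * B)"
    by (rule assoc_res[OF pencil_carrier])
  also have "\<dots> = t \<cdot>\<^sub>m (C * res t * E * (res t * B)) - C * res t * A * (res t * B)"
  proof -
    have P: "C * res t \<in> carrier_mat p n" and Q: "res t * B \<in> carrier_mat n m"
      using carr by auto
    have "C * res t * pencil t = t \<cdot>\<^sub>m (C * res t * E) - C * res t * A"
      unfolding pencil_def mult_minus_distrib_mat[OF P smult_carrier_mat[OF E] A]
        mult_smult_distrib[OF P E] ..
    moreover have "\<dots> * (res t * B) = t \<cdot>\<^sub>m (C * res t * E) * (res t * B) - C * res t * A * (res t * B)"
      using P Q E A by (intro minus_mult_distrib_mat) auto
    moreover have "t \<cdot>\<^sub>m (C * res t * E) * (res t * B) = t \<cdot>\<^sub>m (C * res t * E * (res t * B))"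
      using P Q E by (intro mult_smult_assoc_mat) auto
    ultimately show ?thesis by simp
  qed
  finally show ?thesis
    using B C unfolding mat_deriv_transfer_function[OF t] assoc_res[OF E] assoc_res[OF A]
    by (intro eq_matI) auto
qed

end

section \<open>Data matrices as congruences\<close>

lemma smult_smult_mat:
  fixes M :: "'a :: semigroup_mult mat"
  shows "a \<cdot>\<^sub>m (b \<cdot>\<^sub>m M) = (a * b) \<cdot>\<^sub>m M"
  by (intro eq_matI) (auto simp: mult.assoc)

lemma block_mat_cong:
  assumes "\<And>k j. k < K \<Longrightarrow> j < J \<Longrightarrow> F k j = F' k j"
  shows "block_mat p m K J F = block_mat p m K J F'"
  unfolding block_mat_def
  using assms by (intro cong_mat) (auto simp: less_mult_imp_div_less mult.commute)

lemma index_mat_adjoint_mult_mult: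
  fixes M P Q :: "complex mat"
  assumes "P \<in> carrier_mat n k" "M \<in> carrier_mat n n" "Q \<in> carrier_mat n l" "a < k" "b < l"
  shows "(mat_adjoint P * M * Q) $$ (a, b) = (M *\<^sub>v col Q b) \<bullet>c col P a"
proof -
  have "mat_adjoint P * M * Q = mat_adjoint P * (M * Q)"
    using assms by (intro assoc_mult_mat) auto
  then show ?thesis
    using index_mat_adjoint_mult[of P n k "M * Q" l a b] col_mult2[of M n n Q l b] assms by simp
qed

text \<open>Column \<open>b\<close> of \<open>X\<close> is a weighted column of the block
  \<open>Y (b div m)\<close>, so each entry on the right is a sesquilinear form of two such columns.
  The weights are real, hence conjugation leaves the product of the two weights unchanged.\<close>

lemma block_mat_gram:
  fixes M :: "complex mat" and \<xi> :: "nat \<Rightarrow> real"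
  assumes Y: "\<And>j. j < N \<Longrightarrow> Y j \<in> carrier_mat n m" and M: "M \<in> carrier_mat n n"
  defines "X \<equiv> block_mat n m 1 N (\<lambda>_ j. complex_of_real (\<xi> j) \<cdot>\<^sub>m Y j)"
  shows "block_mat m m N N
      (\<lambda>k j. complex_of_real (\<xi> k * \<xi> j) \<cdot>\<^sub>m (mat_adjoint (Y k) * M * Y j)) =
    mat_adjoint X * M * X"
proof (rule eq_matI)
  have X: "X \<in> carrier_mat n (m * N)" by (simp add: X_def block_mat_def)
  have colX: "col X b = complex_of_real (\<xi> (b div m)) \<cdot>\<^sub>v col (Y (b div m)) (b mod m)"
    if "b < m * N" for b
  proof -
    \<comment> \<open>For m = 0 there is no column at all; for m > 0 the remainder
      \<open>b mod m\<close> is a valid column index inside a block.\<close>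
    have "0 < m" using that by (cases m) auto
    moreover have "b div m < N" using that by (simp add: less_mult_imp_div_less mult.commute)
    ultimately show ?thesis
      using Y[of "b div m"] that by (intro eq_vecI) (auto simp: X_def block_mat_def)
  qed
  fix a b assume "a < dim_row (mat_adjoint X * M * X)" "b < dim_col (mat_adjoint X * M * X)"
  then have ab: "a < m * N" "b < m * N" using X by auto
  then have "0 < m" by (cases m) auto
  have k: "a div m < N" "b div m < N"
    using ab by (simp_all add: less_mult_imp_div_less mult.commute)
  note Ya = Y[OF k(1)] and Yb = Y[OF k(2)]
  have "(mat_adjoint X * M * X) $$ (a, b) = complex_of_real (\<xi> (a div m) * \<xi> (b div m)) *
      ((M *\<^sub>v col (Y (b div m)) (b mod m)) \<bullet>c col (Y (a div m)) (a mod m))"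
    using M Ya Yb mult_mat_vec[OF M, of "col (Y (b div m)) (b mod m)"]
    by (simp add: index_mat_adjoint_mult_mult[OF X M X ab] colX[OF ab(1)] colX[OF ab(2)]
        conjugate_smult_vec carrier_vecI)
  also have "\<dots> = complex_of_real (\<xi> (a div m) * \<xi> (b div m)) *
      (mat_adjoint (Y (a div m)) * M * Y (b div m)) $$ (a mod m, b mod m)"
    using index_mat_adjoint_mult_mult[OF Ya M Yb, of "a mod m" "b mod m"] \<open>0 < m\<close> by simp
  finally show "block_mat m m N N
      (\<lambda>k j. complex_of_real (\<xi> k * \<xi> j) \<cdot>\<^sub>m (mat_adjoint (Y k) * M * Y j)) $$ (a, b) =
    (mat_adjoint X * M * X) $$ (a, b)"
    using ab \<open>0 < m\<close> Ya Yb by (simp add: block_mat_def)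
qed (auto simp: X_def block_mat_def)

section \<open>Factorization of the Hermite data matrices\<close>

context descriptor_system
begin

text \<open>With s = -\<i> \<omega> k and t = \<i> \<omega> j, the case distinction is s = t against
  s \<noteq> t. The minus sign in the data cancels the one in G'(t), respectively the one between s
  - t and t - s, so both cases give the same product.\<close>

lemma data_E_eq:
  assumes inv: "\<And>i. i < N \<Longrightarrow> invertible_mat (pencil (\<i> * complex_of_real (\<omega> i)))"
    "\<And>i. i < N \<Longrightarrow> invertible_mat (pencil (- \<i> * complex_of_real (\<omega> i)))"
  shows "data_E p m N \<omega> \<xi> G (mat_deriv G) = block_mat p m N N (\<lambda>k j. complex_of_real (\<xi> k * \<xi> j) \<cdot>\<^sub>m
    (C * res (- \<i> * \<omega> k) * E * res (\<i> * \<omega> j) * B))"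
  unfolding data_E_def
proof (rule block_mat_cong)
  fix k j assume kj: "k < N" "j < N"
  let ?s = "- \<i> * complex_of_real (\<omega> k)" and ?t = "\<i> * complex_of_real (\<omega> j)"
  let ?c = "complex_of_real (\<xi> k * \<xi> j)"
  note s = inv(2)[OF kj(1)] and t = inv(1)[OF kj(2)]
  show "(if \<omega> j = - \<omega> k then (- ?c) \<cdot>\<^sub>m mat_deriv G ?t
      else (- ?c / (?s - ?t)) \<cdot>\<^sub>m (G ?s - G ?t)) = ?c \<cdot>\<^sub>m (C * res ?s * E * res ?t * B)"
  proof (cases "\<omega> j = - \<omega> k")
    case True
    then have st: "?s = ?t" by simp
    have "(- ?c) \<cdot>\<^sub>m mat_deriv G ?t = ?c \<cdot>\<^sub>m (C * res ?t * E * res ?t * B)"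
      unfolding mat_deriv_transfer_function[OF t] smult_smult_mat by simp
    then show ?thesis unfolding if_P[OF True] st .
  next
    case False
    then have "?s - ?t \<noteq> 0"
      by (simp add: complex_eq_iff)
    then have "- ?c / (?s - ?t) * (?t - ?s) = ?c" by (simp add: field_simps)
    then show ?thesis
      using False by (simp only: transfer_function_diff[OF s t] smult_smult_mat if_False)
  qed
qed

lemma data_A_eq:
  assumes inv: "\<And>i. i < N \<Longrightarrow> invertible_mat (pencil (\<i> * complex_of_real (\<omega> i)))"
    "\<And>i. i < N \<Longrightarrow> invertible_mat (pencil (- \<i> * complex_of_real (\<omega> i)))"
  shows "data_A p m N \<omega> \<xi> G (mat_deriv G) = block_mat p m N N (\<lambda>k j. complex_of_real (\<xi> k * \<xi> j) \<cdot>\<^sub>m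
    (C * res (- \<i> * \<omega> k) * A * res (\<i> * \<omega> j) * B))"
  unfolding data_A_def
proof (rule block_mat_cong)
  fix k j assume kj: "k < N" "j < N"
  let ?s = "- \<i> * complex_of_real (\<omega> k)" and ?t = "\<i> * complex_of_real (\<omega> j)"
  let ?c = "complex_of_real (\<xi> k * \<xi> j)"
  note s = inv(2)[OF kj(1)] and t = inv(1)[OF kj(2)]
  show "(if \<omega> j = - \<omega> k then (- ?c) \<cdot>\<^sub>m (G ?t + ?t \<cdot>\<^sub>m mat_deriv G ?t)
      else (- ?c / (?s - ?t)) \<cdot>\<^sub>m (?s \<cdot>\<^sub>m G ?s - ?t \<cdot>\<^sub>m G ?t)) = ?c \<cdot>\<^sub>m (C * res ?s * A * res ?t * B)"
  proof (cases "\<omega> j = - \<omega> k")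
    case True
    then have st: "?s = ?t" by simp
    have "(- ?c) \<cdot>\<^sub>m (G ?t + ?t \<cdot>\<^sub>m mat_deriv G ?t) = ?c \<cdot>\<^sub>m (C * res ?t * A * res ?t * B)"
      unfolding transfer_function_plus_deriv[OF t] smult_smult_mat by simp
    then show ?thesis unfolding if_P[OF True] st .
  next
    case False
    then have "?s - ?t \<noteq> 0"
      by (simp add: complex_eq_iff)
    then have "- ?c / (?s - ?t) * (?t - ?s) = ?c" by (simp add: field_simps)
    then show ?thesis
      using False by (simp only: transfer_function_scaled_diff[OF s t] smult_smult_mat if_False)
  qed
qed

text \<open>Here \<open>Z\<close> plays the role of W^H and \<open>Ti\<close> that of the inverse of
  \<open>T\<close>. The symmetrized pencil \<open>?P\<close> satisfies P(cnj s)^H = P(s), and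
  \<open>?y\<close> solves P(cnj s) y = Z B. Since Z B is the adjoint of C T, taking adjoints gives
  y^H P(s) = C T, from which \<open>T\<close> and the pencil are cancelled.\<close>

lemma symmetric_left_factor:
  assumes T: "T \<in> carrier_mat n n" and Ti: "Ti \<in> carrier_mat n n" and Z: "Z \<in> carrier_mat n n"
    and TTi: "T * Ti = 1\<^sub>m n"
    and sym: "mat_adjoint (Z * E * T) = Z * E * T" "mat_adjoint (Z * A * T) = Z * A * T"
      "Z * B = mat_adjoint (C * T)"
    and s: "invertible_mat (pencil s)" and cs: "invertible_mat (pencil (cnj s))"
  shows "mat_adjoint (Ti * res (cnj s) * B) * Z = C * res s"
proof -
  let ?P = "\<lambda>s. Z * pencil s * T" and ?y = "Ti * res (cnj s) * B"
  note rc = res_inverse[OF cs] and rs = res_inverse[OF s]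
  have y: "?y \<in> carrier_mat n m" using Ti rc B by auto
  have P: "?P z \<in> carrier_mat n n" for z using Z T pencil_carrier[of z] by auto
  have P_eq: "?P z = z \<cdot>\<^sub>m (Z * E * T) - Z * A * T" for z
  proof -
    have ZE: "Z * E \<in> carrier_mat n n" and ZA: "Z * A \<in> carrier_mat n n" using Z E A by auto
    show ?thesis
      unfolding pencil_def mult_minus_distrib_mat[OF Z smult_carrier_mat[OF E] A]
        mult_smult_distrib[OF Z E] minus_mult_distrib_mat[OF smult_carrier_mat[OF ZE] ZA T]
        mult_smult_assoc_mat[OF ZE T] ..
  qed
  have adj: "mat_adjoint (?P (cnj s)) = ?P s"
  proof -
    have "Z * E * T \<in> carrier_mat n n" "Z * A * T \<in> carrier_mat n n" using Z E A T by auto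
    then show ?thesis
      unfolding P_eq by (simp add: mat_adjoint_minus[of _ n n] mat_adjoint_smult sym)
  qed
  have rB: "res (cnj s) * B \<in> carrier_mat n m" using rc B by auto
  have "T * ?y = T * (Ti * (res (cnj s) * B))" using assoc_mult_mat[OF Ti rc(1) B] by simp
  also have "\<dots> = T * Ti * (res (cnj s) * B)" using assoc_mult_mat[OF T Ti rB] by simp
  finally have Ty: "T * ?y = res (cnj s) * B" using TTi left_mult_one_mat[OF rB] by simp
  have ZP: "Z * pencil z \<in> carrier_mat n n" for z using Z pencil_carrier[of z] by auto
  \<comment> \<open>The product \<open>T * ?y\<close> undoes the change of coordinates, leaving the
    resolvent next to its own pencil.\<close>
  have "?P (cnj s) * ?y = Z * pencil (cnj s) * (T * ?y)"
    by (rule assoc_mult_mat[OF ZP T y])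
  also have "\<dots> = Z * (pencil (cnj s) * (res (cnj s) * B))"
    unfolding Ty by (rule assoc_mult_mat[OF Z pencil_carrier rB])
  also have "pencil (cnj s) * (res (cnj s) * B) = B"
    using assoc_mult_mat[OF pencil_carrier[of "cnj s"] rc(1) B] rc(2) left_mult_one_mat[OF B] by simp
  finally have "mat_adjoint (?P (cnj s) * ?y) = C * T"
    using sym(3) by simp
  then have "mat_adjoint ?y * ?P s = C * T"
    using mat_adjoint_mult[OF P y] adj by simp
  moreover have ya: "mat_adjoint ?y \<in> carrier_mat m n" using y by (rule mat_adjoint_carrier)
  have "mat_adjoint ?y * ?P s = mat_adjoint ?y * (Z * pencil s) * T"
    using assoc_mult_mat[OF ya ZP T] by simp
  ultimately have "mat_adjoint ?y * (Z * pencil s) * T * Ti = C * T * Ti" by simp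
  moreover have yZP: "mat_adjoint ?y * (Z * pencil s) \<in> carrier_mat m n"
    using ya ZP by (rule mult_carrier_mat)
  ultimately have "mat_adjoint ?y * (Z * pencil s) = C"
    using assoc_mult_mat[OF yZP T Ti] assoc_mult_mat[OF C T Ti] TTi C
      right_mult_one_mat[OF yZP] by simp
  moreover have "mat_adjoint ?y * (Z * pencil s) = mat_adjoint ?y * Z * pencil s"
    using assoc_mult_mat[OF ya Z pencil_carrier] by simp
  ultimately have "mat_adjoint ?y * Z * pencil s * res s = C * res s" by simp
  moreover have yZ: "mat_adjoint ?y * Z \<in> carrier_mat m n" using ya Z by auto
  ultimately show ?thesis
    using assoc_mult_mat[OF yZ pencil_carrier rs(1)] rs(2) right_mult_one_mat[OF yZ] by simp
qed

text \<open>Replaces \<open>C * res s\<close> by the adjoint factor and introduces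
  \<open>T * Ti\<close> before \<open>res t\<close>. Taking \<open>M\<close> to be \<open>E\<close>
  or \<open>A\<close> treats both data matrices with the same outer factors.\<close>

lemma symmetric_factorization:
  assumes T: "T \<in> carrier_mat n n" and Ti: "Ti \<in> carrier_mat n n" and Z: "Z \<in> carrier_mat n n"
    and TTi: "T * Ti = 1\<^sub>m n"
    and sym: "mat_adjoint (Z * E * T) = Z * E * T" "mat_adjoint (Z * A * T) = Z * A * T"
      "Z * B = mat_adjoint (C * T)"
    and s: "invertible_mat (pencil s)" "invertible_mat (pencil (cnj s))"
    and t: "invertible_mat (pencil t)" and M: "M \<in> carrier_mat n n"
  shows "C * res s * M * res t * B =
    mat_adjoint (Ti * res (cnj s) * B) * (Z * M * T) * (Ti * res t * B)"
proof -
  let ?y = "\<lambda>s. Ti * res s * B"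
  note rt = res_inverse(1)[OF t]
  have ya: "mat_adjoint (?y (cnj s)) \<in> carrier_mat m n"
    using Ti res_inverse(1)[OF s(2)] B by (intro mat_adjoint_carrier) auto
  have yt: "?y t \<in> carrier_mat n m" using Ti rt B by auto
  have rB: "res t * B \<in> carrier_mat n m" using rt B by auto
  have ZM: "Z * M \<in> carrier_mat n n" using Z M by auto
  have Crs: "C * res s \<in> carrier_mat p n" using C res_inverse(1)[OF s(1)] by auto
  then have CM: "C * res s * M \<in> carrier_mat p n" using M by auto
  have "T * ?y t = T * (Ti * (res t * B))" using assoc_mult_mat[OF Ti rt B] by simp
  also have "\<dots> = T * Ti * (res t * B)" using assoc_mult_mat[OF T Ti rB] by simp
  finally have Ty: "T * ?y t = res t * B" using TTi left_mult_one_mat[OF rB] by simp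
  have "mat_adjoint (?y (cnj s)) * (Z * M * T) * ?y t =
      mat_adjoint (?y (cnj s)) * (Z * M) * T * ?y t"
    using assoc_mult_mat[OF ya ZM T] by simp
  also have "\<dots> = mat_adjoint (?y (cnj s)) * (Z * M) * (T * ?y t)"
    using mult_carrier_mat[OF ya ZM] T yt by (rule assoc_mult_mat)
  also have "mat_adjoint (?y (cnj s)) * (Z * M) = mat_adjoint (?y (cnj s)) * Z * M"
    using assoc_mult_mat[OF ya Z M] by simp
  also have "mat_adjoint (?y (cnj s)) * Z = C * res s"
    using symmetric_left_factor[OF T Ti Z TTi sym s] .
  also have "C * res s * M * (T * ?y t) = C * res s * M * res t * B"
    unfolding Ty using assoc_mult_mat[OF CM rt B] by simp
  finally show ?thesis ..
qed

end

section \<open>The reduced model\<close>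

text \<open>For an eigenvector v with eigenvalue \<mu>, the form of \<open>A\<close> at Y v equals
  \<mu> times the positive real number v^H v. The normalization by \<open>E\<close> excludes Y v =
  0, so the form has negative real part.\<close>

lemma congruence_asymptotically_stable:
  fixes E A Y :: "complex mat"
  assumes E: "E \<in> carrier_mat n n" and A: "A \<in> carrier_mat n n" and Y: "Y \<in> carrier_mat n r"
    and "neg_def A" and YEY: "mat_adjoint Y * E * Y = 1\<^sub>m r"
  shows "asymptotically_stable (1\<^sub>m r, mat_adjoint Y * A * Y, B, C)"
  unfolding asymptotically_stable_def
proof clarsimp
  fix \<mu> assume "pencil_eigenvalue (1\<^sub>m r) (mat_adjoint Y * A * Y) \<mu>"
  let ?A = "mat_adjoint Y * A * Y"
  have A': "?A \<in> carrier_mat r r" using Y A by auto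
  have "det (\<mu> \<cdot>\<^sub>m 1\<^sub>m r - ?A) = 0" and c: "\<mu> \<cdot>\<^sub>m 1\<^sub>m r - ?A \<in> carrier_mat r r"
    using \<open>pencil_eigenvalue _ _ _\<close> minus_carrier_mat[OF A'] by (auto simp: pencil_eigenvalue_def)
  then obtain v where v: "v \<in> carrier_vec r" "v \<noteq> 0\<^sub>v r"
    and "(\<mu> \<cdot>\<^sub>m 1\<^sub>m r - ?A) *\<^sub>v v = 0\<^sub>v r"
    using det_0_iff_vec_prod_zero by blast
  moreover have "(\<mu> \<cdot>\<^sub>m 1\<^sub>m r - ?A) *\<^sub>v v = \<mu> \<cdot>\<^sub>v v - ?A *\<^sub>v v"
  proof -
    have "(\<mu> \<cdot>\<^sub>m 1\<^sub>m r) *\<^sub>v v = \<mu> \<cdot>\<^sub>v v"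
      using v by (intro eq_vecI) auto
    then show ?thesis
      using v A' minus_mult_distrib_mat_vec[of "\<mu> \<cdot>\<^sub>m 1\<^sub>m r" r r ?A v] by simp
  qed
  ultimately have eq: "\<mu> \<cdot>\<^sub>v v - ?A *\<^sub>v v = 0\<^sub>v r" by simp
  have "(?A *\<^sub>v v) $ i = (\<mu> \<cdot>\<^sub>v v) $ i" if "i < r" for i
    using that v A' Y arg_cong[OF eq, of "\<lambda>x. x $ i"] by simp
  then have "?A *\<^sub>v v = \<mu> \<cdot>\<^sub>v v"
    using v A' Y by (intro eq_vecI) auto
  then have form: "(A *\<^sub>v (Y *\<^sub>v v)) \<bullet>c (Y *\<^sub>v v) = \<mu> * (v \<bullet>c v)"
    using cscalar_prod_congruence[OF Y A v(1)] v by simp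
  \<comment> \<open>If Y v were zero, this identity would force the squared norm of v to
    vanish.\<close>
  have "(E *\<^sub>v (Y *\<^sub>v v)) \<bullet>c (Y *\<^sub>v v) = v \<bullet>c v"
    using cscalar_prod_congruence[OF Y E v(1)] YEY v by simp
  moreover have "v \<bullet>c v \<noteq> 0" using v by simp
  moreover have "(E *\<^sub>v 0\<^sub>v n) \<bullet>c 0\<^sub>v n = 0" using E by (simp add: scalar_prod_def)
  ultimately have "Y *\<^sub>v v \<noteq> 0\<^sub>v n" by auto
  moreover have "Y *\<^sub>v v \<in> carrier_vec n" using Y v by simp
  ultimately have "Re (\<mu> * (v \<bullet>c v)) < 0"
    using \<open>neg_def A\<close> A unfolding form[symmetric] neg_def_def by auto
  then have "Re \<mu> * Re (v \<bullet>c v) < 0"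
    using cscalar_prod_self(1)[OF v(1)] by simp
  then show "Re \<mu> < 0"
    using cscalar_prod_self(2)[OF v] by (simp add: mult_less_0_iff)
qed

text \<open>Reassociation, together with self-adjointness of the real diagonal scaling. The middle
  matrix is left general because both the normalization (with \<open>Et\<close>) and the reduced
  state matrix (with \<open>At\<close>) have this shape.\<close>

lemma reduced_state_matrix_congruence:
  fixes X :: "complex mat" and S1 :: "real mat"
  assumes X: "X \<in> carrier_mat n d" and V: "V \<in> carrier_mat d r" and S1: "S1 \<in> carrier_mat r r"
    and M: "M \<in> carrier_mat n n"
  defines "Y \<equiv> X * (V * diag_inv_sqrt S1)"
  shows "Y \<in> carrier_mat n r"
    and "mat_adjoint Y * M * Y =
      diag_inv_sqrt S1 * mat_adjoint V * (mat_adjoint X * M * X) * V * diag_inv_sqrt S1"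
proof -
  let ?D = "diag_inv_sqrt S1"
  have D: "?D \<in> carrier_mat r r" using S1 by (simp add: diag_inv_sqrt_def)
  have Da: "mat_adjoint ?D = ?D" unfolding diag_inv_sqrt_def by (rule mat_adjoint_real_diag)
  have VD: "V * ?D \<in> carrier_mat d r" using V D by auto
  then show Y: "Y \<in> carrier_mat n r" unfolding Y_def using X by auto
  have Xa: "mat_adjoint X \<in> carrier_mat d n" and Va: "mat_adjoint V \<in> carrier_mat r d"
    using X V by (auto intro: mat_adjoint_carrier)
  have DV: "?D * mat_adjoint V \<in> carrier_mat r d" using D Va by auto
  have XM: "mat_adjoint X * M \<in> carrier_mat d n" using Xa M by auto
  have XMX: "mat_adjoint X * M * X \<in> carrier_mat d d" using XM X by auto
  have Ya: "mat_adjoint Y = ?D * mat_adjoint V * mat_adjoint X"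
    unfolding Y_def mat_adjoint_mult[OF X VD] mat_adjoint_mult[OF V D] Da ..
  have "mat_adjoint Y * M * Y = ?D * mat_adjoint V * (mat_adjoint X * M) * (X * (V * ?D))"
    unfolding Ya assoc_mult_mat[OF DV Xa M] by (simp add: Y_def)
  also have "\<dots> = ?D * mat_adjoint V * (mat_adjoint X * M * X) * (V * ?D)"
    using assoc_mult_mat[OF mult_carrier_mat[OF DV XM] X VD] assoc_mult_mat[OF DV XM X] by simp
  also have "\<dots> = ?D * mat_adjoint V * (mat_adjoint X * M * X) * V * ?D"
    using assoc_mult_mat[OF mult_carrier_mat[OF DV XMX] V D] by simp
  finally show "mat_adjoint Y * M * Y =
      ?D * mat_adjoint V * (mat_adjoint X * M * X) * V * ?D" .
qed

text \<open>Orthonormality turns V^H W V into the diagonal matrix of singular values, which the two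
  inverse square roots scale to the identity. It is applied with the data matrix
  \<open>data_E\<close> as \<open>W\<close>.\<close>

lemma diag_inv_sqrt_balances:
  fixes V W :: "complex mat" and S1 :: "real mat"
  assumes V: "V \<in> carrier_mat d r" and S1: "S1 \<in> carrier_mat r r" and W: "W \<in> carrier_mat d d"
    and WV: "W * V = V * mat_diag r (\<lambda>i. complex_of_real (S1 $$ (i, i)))"
    and VV: "mat_adjoint V * V = 1\<^sub>m r" and pos: "\<And>i. i < r \<Longrightarrow> 0 < S1 $$ (i, i)"
  shows "diag_inv_sqrt S1 * mat_adjoint V * W * V * diag_inv_sqrt S1 = 1\<^sub>m r"
proof -
  let ?D = "diag_inv_sqrt S1" and ?S = "mat_diag r (\<lambda>i. complex_of_real (S1 $$ (i, i)))"
  have D: "?D \<in> carrier_mat r r" using S1 by (simp add: diag_inv_sqrt_def)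
  have S: "?S \<in> carrier_mat r r" by simp
  have Va: "mat_adjoint V \<in> carrier_mat r d" using V by (rule mat_adjoint_carrier)
  have DV: "?D * mat_adjoint V \<in> carrier_mat r d" using D Va by auto
  have "?D * mat_adjoint V * W * V = ?D * mat_adjoint V * (V * ?S)"
    using assoc_mult_mat[OF DV W V] WV by simp
  also have "\<dots> = ?D * (mat_adjoint V * V) * ?S"
    using assoc_mult_mat[OF DV V S] assoc_mult_mat[OF D Va V] by simp
  also have "\<dots> = ?D * ?S" using VV right_mult_one_mat[OF D] by simp
  finally have "?D * mat_adjoint V * W * V * ?D = ?D * ?S * ?D" by simp
  also have "\<dots> = mat_diag r (\<lambda>i. complex_of_real
      (1 / sqrt (S1 $$ (i, i)) * S1 $$ (i, i) * (1 / sqrt (S1 $$ (i, i)))))"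
    unfolding diag_inv_sqrt_def carrier_matD(1)[OF S1] mat_diag_diag of_real_mult ..
  also have "\<dots> = 1\<^sub>m r"
  proof (rule eq_matI)
    fix i j assume "i < dim_row (1\<^sub>m r :: complex mat)" "j < dim_col (1\<^sub>m r :: complex mat)"
    moreover have "1 / sqrt x * x * (1 / sqrt x) = 1" if "0 < x" for x :: real
      using that real_sqrt_mult_self[of x] by (simp add: field_simps)
    ultimately show "mat_diag r (\<lambda>i. complex_of_real
        (1 / sqrt (S1 $$ (i, i)) * S1 $$ (i, i) * (1 / sqrt (S1 $$ (i, i))))) $$ (i, j) = 1\<^sub>m r $$ (i, j)"
      using pos[of j] by (auto simp: mat_diag_def simp del: of_real_mult of_real_divide)
  qed (auto simp: mat_diag_def)
  finally show ?thesis .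
qed

theorem corollary1:
  fixes n m p N r :: nat
    and E A B C U1 U2 V1 V2 :: "complex mat"
    and S1 S2 :: "real mat"
    and G :: "complex \<Rightarrow> complex mat"
    and \<omega> \<xi> :: "nat \<Rightarrow> real"
  assumes "E \<in> carrier_mat n n" and "A \<in> carrier_mat n n"
    and "B \<in> carrier_mat n m" and "C \<in> carrier_mat p n"
    and "G = transfer_function E A B C"
    and "\<exists>T \<in> carrier_mat n n. \<exists>W \<in> carrier_mat n n.
           pos_def (mat_adjoint W * E * T) \<and>
           neg_def (mat_adjoint W * A * T) \<and>
           mat_adjoint W * B = mat_adjoint (C * T)"
    and "N \<ge> 1"
    and "\<forall>i < N. invertible_mat ((\<i> * complex_of_real (\<omega> i)) \<cdot>\<^sub>m E - A) \<and>
                 invertible_mat ((- \<i> * complex_of_real (\<omega> i)) \<cdot>\<^sub>m E - A)"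
    and "partitioned_svd (data_E p m N \<omega> \<xi> G (mat_deriv G)) r U1 U2 S1 S2 V1 V2"
    and "invertible_mat S1"
  shows "asymptotically_stable
           (reduced_model r
              (data_A p m N \<omega> \<xi> G (mat_deriv G)) (data_B p m N \<omega> \<xi> G) (data_C p m N \<omega> \<xi> G)
              U1 S1 V1)"
proof -
  obtain T W where T: "T \<in> carrier_mat n n" and W: "W \<in> carrier_mat n n"
    and pos: "pos_def (mat_adjoint W * E * T)" and neg: "neg_def (mat_adjoint W * A * T)"
    and BC: "mat_adjoint W * B = mat_adjoint (C * T)"
    using assms(6) by blast
  interpret descriptor_system n m p E A B C
    by unfold_locales (use assms in auto)
  define Z where "Z = mat_adjoint W"
  have Z: "Z \<in> carrier_mat n n" using W unfolding Z_def by (rule mat_adjoint_carrier)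
  define Et where "Et = Z * E * T"
  define At where "At = Z * A * T"
  have ZE: "Z * E \<in> carrier_mat n n" and Et: "Et \<in> carrier_mat n n" and At: "At \<in> carrier_mat n n"
    using Z E A T by (auto simp: Et_def At_def)
  have herm: "mat_adjoint Et = Et" "mat_adjoint At = At"
    using pos neg unfolding Et_def At_def Z_def pos_def_def neg_def_def hermitian_mat_def by auto
  have pos: "pos_def Et" and neg: "neg_def At"
    using pos neg by (simp_all add: Et_def At_def Z_def)
  have "p = m"
    using arg_cong[OF BC, of dim_col] B C by simp
  have "det Et \<noteq> 0" using pos Et by (rule pos_def_det_nonzero)
  \<comment> \<open>The hypothesis only provides some square \<open>T\<close>; a nonzero determinant
    of the product \<open>Z * E * T\<close> makes it invertible.\<close>
  then have "det T \<noteq> 0" unfolding Et_def det_mult[OF ZE T] by simp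
  then have "invertible_mat T" using invertible_mat_iff_det[OF T] by simp
  note Ti = the_mat_inverse[OF T this]
  define Ti where "Ti = the (mat_inverse T)"
  note Ti = Ti[folded Ti_def]
  note sym = herm[unfolded Et_def At_def] BC[folded Z_def]
  have inv: "invertible_mat (pencil (\<i> * complex_of_real (\<omega> i)))"
    "invertible_mat (pencil (- \<i> * complex_of_real (\<omega> i)))" if "i < N" for i
    using assms(8) that by (auto simp: pencil_def)
  \<comment> \<open>In the symmetric coordinates this is the solution y of (\<i> \<omega> j Et - At)
    y = W^H B; \<open>X\<close> collects these solutions with their quadrature weights.\<close>
  define Y where "Y j = Ti * res (\<i> * complex_of_real (\<omega> j)) * B" for j
  have Y: "Y j \<in> carrier_mat n m" if "j < N" for j
    using Ti(1) res_inverse(1)[OF inv(1)[OF that]] B by (auto simp: Y_def)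
  define X where "X = block_mat n m 1 N (\<lambda>_ j. complex_of_real (\<xi> j) \<cdot>\<^sub>m Y j)"
  have X: "X \<in> carrier_mat n (m * N)" by (simp add: X_def block_mat_def)
  have block: "C * res (- \<i> * complex_of_real (\<omega> k)) * M * res (\<i> * complex_of_real (\<omega> j)) * B =
      mat_adjoint (Y k) * (Z * M * T) * Y j"
    if "k < N" "j < N" "M \<in> carrier_mat n n" for k j M
  proof -
    \<comment> \<open>Conjugation sends each left node to the right node with the same index. This
      is where the symmetric pair of quadrature rules matters: the left factors are the adjoints of
      the same \<open>Y k\<close>.\<close>
    have "cnj (- \<i> * complex_of_real (\<omega> k)) = \<i> * complex_of_real (\<omega> k)" by simp
    then show ?thesis
      using symmetric_factorization[OF T Ti(1) Z Ti(2) sym inv(2)[OF that(1)] _ inv(1)[OF that(2)] that(3)]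
        inv(1)[OF that(1)] unfolding Y_def by metis
  qed
  let ?DE = "data_E p m N \<omega> \<xi> G (mat_deriv G)" and ?DA = "data_A p m N \<omega> \<xi> G (mat_deriv G)"
  have DE: "?DE = mat_adjoint X * Et * X"
  proof -
    have "?DE = block_mat p m N N (\<lambda>k j. complex_of_real (\<xi> k * \<xi> j) \<cdot>\<^sub>m
        (C * res (- \<i> * \<omega> k) * E * res (\<i> * \<omega> j) * B))"
      unfolding assms(5) by (rule data_E_eq[OF inv])
    also have "\<dots> = block_mat m m N N (\<lambda>k j. complex_of_real (\<xi> k * \<xi> j) \<cdot>\<^sub>m
        (mat_adjoint (Y k) * Et * Y j))"
      unfolding \<open>p = m\<close> Et_def by (rule block_mat_cong) (simp only: block E)
    also have "\<dots> = mat_adjoint X * Et * X"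
      unfolding X_def using Y Et by (rule block_mat_gram)
    finally show ?thesis .
  qed
  have DA: "?DA = mat_adjoint X * At * X"
  proof -
    have "?DA = block_mat p m N N (\<lambda>k j. complex_of_real (\<xi> k * \<xi> j) \<cdot>\<^sub>m
        (C * res (- \<i> * \<omega> k) * A * res (\<i> * \<omega> j) * B))"
      unfolding assms(5) by (rule data_A_eq[OF inv])
    also have "\<dots> = block_mat m m N N (\<lambda>k j. complex_of_real (\<xi> k * \<xi> j) \<cdot>\<^sub>m
        (mat_adjoint (Y k) * At * Y j))"
      unfolding \<open>p = m\<close> At_def by (rule block_mat_cong) (simp only: block A)
    also have "\<dots> = mat_adjoint X * At * X"
      unfolding X_def using Y At by (rule block_mat_gram)
    finally show ?thesis .
  qed
  have XE: "mat_adjoint X * Et \<in> carrier_mat (m * N) n"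
    using mat_adjoint_carrier[OF X] Et by (rule mult_carrier_mat)
  then have DE_carrier: "?DE \<in> carrier_mat (m * N) (m * N)"
    unfolding DE using X by (rule mult_carrier_mat)
  have DE_herm: "mat_adjoint ?DE = ?DE"
    unfolding DE mat_adjoint_mult[OF XE X] mat_adjoint_mult[OF mat_adjoint_carrier[OF X] Et] herm
    using assoc_mult_mat[OF mat_adjoint_carrier[OF X] Et X] by simp
  have DE_psd: "\<forall>x \<in> carrier_vec (m * N). 0 \<le> Re ((?DE *\<^sub>v x) \<bullet>c x)"
  proof
    fix x :: "complex vec"
    assume x: "x \<in> carrier_vec (m * N)"
    show "0 \<le> Re ((?DE *\<^sub>v x) \<bullet>c x)"
      unfolding DE cscalar_prod_congruence[OF X Et x]
      by (rule pos_def_nonneg[OF pos Et mult_mat_vec_carrier[OF X x]])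
  qed
  note svd = psd_partitioned_svd[OF DE_carrier DE_herm DE_psd
      assms(9,10)]
  have V1: "V1 \<in> carrier_mat (m * N) r" using svd(1,3) by simp
  note cong = reduced_state_matrix_congruence[OF X V1 svd(2)]
  let ?Y = "X * (V1 * diag_inv_sqrt S1)"
  \<comment> \<open>The singular values of \<open>data_E\<close> are exactly what the scaling in
    \<open>?Y\<close> normalizes.\<close>
  have "mat_adjoint ?Y * Et * ?Y = 1\<^sub>m r"
    unfolding cong(2)[OF Et] DE[symmetric]
    using V1 svd(2) DE_carrier svd(6,4,5) by (rule diag_inv_sqrt_balances)
  from congruence_asymptotically_stable[OF Et At cong(1)[OF At] neg this]
  \<comment> \<open>Rewriting \<open>U1\<close> to \<open>V1\<close> turns the two-sided projection
    of \<open>data_A\<close> into a congruence of \<open>At\<close> by \<open>?Y\<close>.\<close>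
  show ?thesis
    unfolding reduced_model_def cong(2)[OF At] DA svd(3) .
qed

end
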